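(* Suppose $(X,X')\in\{(B,C),(C,B),(D,D)\}$. Let $\underline p$ be a partition of type $X$ and let $b,d$ be positive integers. Then $$d_{BV}([b^{2d}]\sqcup\underline p)=\big([(2d)^b]+d_{BV}(\underline p)\big)_{X'}.$$
   Context: A partition of $n$ is of type $B$ if $n$ is odd and every even part has even multiplicity; of type $C$ if $n$ is even and every odd part has even multiplicity; of type $D$ if $n$ is even and every even part has even multiplicity. $[b^{k}]$ denotes the partition with $k$ parts equal to $b$. $\underline p\sqcup\underline q$ is the union of partitions as multisets of parts; $\underline p+\underline q$ is the partwise sum of the non-increasing sequences (padded by zeros). For a partition $\underline p=[p_1\ge\dots\ge p_N>0]$: $\underline p^+=[p_1+1,p_2,\dots,p_N]$, $\underline p^-=[p_1,\dots,p_{N-1},p_N-1]$, and $\underline p^*$ is the transpose (conjugate). For $X\in\{B,C,D\}$ and $\underline p$ a partition of $n$ ($n$ odd if $X=B$, even if $X\in\{C,D\}$), the $X$-collapse $\underline p_X$ is the unique maximal partition of $n$ of type $X$ with $\underline p_X\le\underline p$ in the dominance order. The Barbasch-Vogan duality map on partitions is: $d_{BV}(\underline p)=((\underline p^-)_C)^*$ for $\underline p$ of type $B$; $d_{BV}(\underline p)=((\underline p^+)_B)^*$ for $\underline p$ of type $C$; $d_{BV}(\underline p)=(\underline p^* )_D$ for $\underline p$ of type $D$. In each case the type of the partition to which $d_{BV}$ is applied in the lemma is $X$. *)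

theory Defs
  imports "HOL-Library.Multiset"
begin

text \<open>
  A partition is the multiset of its parts, all of them positive; it is a partition of
  \<^term>\<open>sum_mset p\<close>. The union of partitions is therefore multiset sum, and
  \<^term>\<open>replicate_mset k b\<close> is the partition with \<open>k\<close> parts equal to \<open>b\<close>.
\<close>

definition is_partition :: "nat multiset \<Rightarrow> bool" where
  "is_partition p \<longleftrightarrow> 0 \<notin># p"

text \<open>
  \<open>part p i\<close> is the entry with 0-based index \<open>i\<close> of the non-increasing sequence of parts,
  padded by zeros.
\<close>

definition part :: "nat multiset \<Rightarrow> nat \<Rightarrow> nat" where
  "part p i = (if i < size p then rev (sorted_list_of_multiset p) ! i else 0)"

definition partwise_sum :: "nat multiset \<Rightarrow> nat multiset \<Rightarrow> nat multiset" where
  "partwise_sum p q =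
     image_mset (\<lambda>i. part p i + part q i) (mset_set {..<max (size p) (size q)})"

definition dominated :: "nat multiset \<Rightarrow> nat multiset \<Rightarrow> bool" where
  "dominated q p \<longleftrightarrow>
     sum_mset q = sum_mset p \<and> (\<forall>k. (\<Sum>i<k. part q i) \<le> (\<Sum>i<k. part p i))"

text \<open>
  The part with 0-based index \<open>j\<close> of the transpose is the number of parts exceeding \<open>j\<close>.
\<close>

definition transpose_partition :: "nat multiset \<Rightarrow> nat multiset" where
  "transpose_partition p =
     image_mset (\<lambda>j. size {#x \<in># p. j < x#}) (mset_set {..<part p 0})"

text \<open>
  The largest part of the empty partition is read as \<open>0\<close>, so that raising it gives the
  partition \<open>[1]\<close>. This case occurs: the empty partition is of type C.
\<close>

definition raise_first :: "nat multiset \<Rightarrow> nat multiset" where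
  "raise_first p = add_mset (part p 0 + 1) (p - {#part p 0#})"

text \<open>
  A smallest part equal to \<open>1\<close> disappears when it is lowered. The value at the empty
  partition is irrelevant, since partitions of type B are nonempty.
\<close>

definition lower_last :: "nat multiset \<Rightarrow> nat multiset" where
  "lower_last p = (let m = part p (size p - 1) in
     {#x \<in># add_mset (m - 1) (p - {#m#}). x \<noteq> 0#})"

datatype partition_type = Type_B | Type_C | Type_D

fun of_type :: "partition_type \<Rightarrow> nat multiset \<Rightarrow> bool" where
  "of_type Type_B p \<longleftrightarrow> is_partition p \<and> odd (sum_mset p) \<and>
     (\<forall>k. k \<in># p \<and> even k \<longrightarrow> even (count p k))"
| "of_type Type_C p \<longleftrightarrow> is_partition p \<and> even (sum_mset p) \<and>
     (\<forall>k. k \<in># p \<and> odd k \<longrightarrow> even (count p k))"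
| "of_type Type_D p \<longleftrightarrow> is_partition p \<and> even (sum_mset p) \<and>
     (\<forall>k. k \<in># p \<and> even k \<longrightarrow> even (count p k))"

text \<open>
  The collapse is meaningful when the parity of \<^term>\<open>sum_mset p\<close> is the one required by
  the type (odd for B, even for C and D).
\<close>

definition collapse :: "partition_type \<Rightarrow> nat multiset \<Rightarrow> nat multiset" where
  "collapse X p = (THE q. of_type X q \<and> dominated q p \<and>
     (\<forall>r. of_type X r \<and> dominated r p \<and> dominated q r \<longrightarrow> r = q))"

text \<open>
  The type is an argument because a partition can be both of type C and of type D.
\<close>

fun d_BV :: "partition_type \<Rightarrow> nat multiset \<Rightarrow> nat multiset" where
  "d_BV Type_B p = transpose_partition (collapse Type_C (lower_last p))"
| "d_BV Type_C p = transpose_partition (collapse Type_B (raise_first p))"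
| "d_BV Type_D p = collapse Type_D (transpose_partition p)"

end

theory Submission
  imports Defs
begin

text \<open>
  The collapse has a local description: it lowers certain partial sums of the parts by one, and
  whether this happens at \<open>k\<close> depends only on the parity of the partial sum and on the parts next
  to \<open>k\<close>. Two consequences give the theorem. Comparing parities at the corners of the diagram
  shows that this operation commutes with transposition on partitions of the relevant type, so
  that \<open>d\<^sub>B\<^sub>V p\<close> is \<open>((p\<^sup>*)\<^sup>-)\<^sub>C\<close>, \<open>((p\<^sup>*)\<^sup>+)\<^sub>B\<close> or \<open>(p\<^sup>*)\<^sub>D\<close>. Moreover, adding a partition \<open>a\<close>
  with even parts preserves parities and can only destroy equalities between adjacent parts, hence
  collapsing \<open>q\<close> before adding \<open>a\<close> does not change the collapse of \<open>a + q\<close>. Finally,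
  \<open>([b\<^sup>2\<^sup>d] \<squnion> p)\<^sup>* = [(2d)\<^sup>b] + p\<^sup>*\<close>.
\<close>

section \<open>Collapse of sequences by partial sums\<close>

definition young :: "(nat \<Rightarrow> nat) \<Rightarrow> bool" where
  "young f \<longleftrightarrow> antimono f \<and> (\<exists>N. \<forall>i\<ge>N. f i = 0)"

definition admissible :: "nat \<Rightarrow> (nat \<Rightarrow> nat) \<Rightarrow> bool" where
  "admissible s f \<longleftrightarrow> (\<forall>k. f (Suc k) < f k \<longrightarrow> even ((\<Sum>i<Suc k. f i) + s * Suc k))"

text \<open>
  With \<open>S\<^sub>k\<close> the sum of the first \<open>k\<close> entries, a sequence is of type C (\<open>s = 0\<close>) or of type
  B/D (\<open>s = 1\<close>) iff \<open>S\<^sub>k + s k\<close> is even at every strict descent. The collapse of \<open>f\<close> lowers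
  \<open>S\<^sub>k\<close> by one where this parity is wrong, except in the interior of a run of equal
  entries \<open>c\<close> with \<open>c + s\<close> odd. The offset \<open>u\<close> adds \<open>u\<close> to every \<open>S\<^sub>k\<close>, also to \<open>S\<^sub>0\<close>; thus
  \<open>(u, s) = (0, 0)\<close>, \<open>(1, 1)\<close>, \<open>(0, 1)\<close> give \<open>(p\<^sup>-)\<^sub>C\<close> (for \<open>p\<close> of odd size), \<open>(p\<^sup>+)\<^sub>B\<close> and
  \<open>p\<^sub>D\<close>.
\<close>

definition deficit :: "nat \<Rightarrow> nat \<Rightarrow> (nat \<Rightarrow> nat) \<Rightarrow> nat \<Rightarrow> bool" where
  "deficit u s f k \<longleftrightarrow> odd (u + (\<Sum>i<k. f i) + s * k) \<and>
     (k = 0 \<or> \<not> (f (k - 1) = f k \<and> odd (f k + s)))"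

definition collapse_seq :: "nat \<Rightarrow> nat \<Rightarrow> (nat \<Rightarrow> nat) \<Rightarrow> nat \<Rightarrow> nat" where
  "collapse_seq u s f i = f i + of_bool (deficit u s f i) - of_bool (deficit u s f (Suc i))"

lemma youngD: "young f \<Longrightarrow> i \<le> j \<Longrightarrow> f j \<le> f i"
  by (auto simp: young_def antimono_def)

lemma young_step: "young f \<Longrightarrow> f (Suc i) \<le> f i"
  by (simp add: youngD)

lemma youngI:
  assumes "\<And>i. f (Suc i) \<le> f i" and "\<And>i. i \<ge> N \<Longrightarrow> f i = 0"
  shows "young f"
  unfolding young_def using assms by (auto simp: antimono_iff_le_Suc)

text \<open>A deficit inside a run of equal entries \<open>c\<close> forces \<open>c + s\<close> to
  be even. The parity is then constant along the run, so the deficit spreads to both neighbouring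
  positions; \<open>deficit_forward\<close> is the other direction.\<close>

lemma deficit_backward:
  assumes "f (Suc i) = f i" and "deficit u s f (Suc i)"
  shows "deficit u s f i"
  using assms unfolding deficit_def by (cases i) auto

lemma deficit_forward:
  assumes "f (Suc i) = f i" and "deficit u s f (Suc i)"
  shows "deficit u s f (Suc (Suc i))"
  using assms unfolding deficit_def by auto

text \<open>Guards the truncated subtraction in \<open>collapse_seq\<close>: a zero entry starts a
  run of zeros, where a deficit behind it comes with one before it.\<close>

lemma deficit_le_collapse:
  assumes "young f"
  shows "of_bool (deficit u s f (Suc i)) \<le> f i + of_bool (deficit u s f i)"
proof (cases "f i = 0")
  case True
  then have "f (Suc i) = f i"
    using young_step[OF assms, of i] by simp
  then show ?thesis
    using deficit_backward[of f i u s] by (auto simp: of_bool_def)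
qed (auto simp: of_bool_def)

lemma collapse_seq_add:
  assumes "young f"
  shows "collapse_seq u s f i + of_bool (deficit u s f (Suc i)) = f i + of_bool (deficit u s f i)"
  using deficit_le_collapse[OF assms, of u s i] by (simp add: collapse_seq_def)

text \<open>The corrections telescope. The boundary term is \<open>u\<close>, since a deficit at
  \<open>0\<close> just means that \<open>u\<close> is odd.\<close>

lemma sum_collapse_seq:
  assumes "young f" and "u \<le> 1"
  shows "(\<Sum>i<k. collapse_seq u s f i) + of_bool (deficit u s f k) = (\<Sum>i<k. f i) + u"
proof (induction k)
  case 0
  then show ?case using assms(2) by (cases u) (auto simp: deficit_def)
next
  case (Suc k)
  then show ?case using collapse_seq_add[OF assms(1), of u s k] by simp
qed

text \<open>With \<open>d\<close> the indicator of the deficits, the collapse drops at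
  \<open>i\<close> by the drop of \<open>f\<close> plus
  \<open>d i - 2 * d (i + 1) + d (i + 2)\<close>. Only drops of 0 and 1 therefore need an
  argument.\<close>

lemma collapse_seq_decreasing:
  assumes "young f"
  shows "collapse_seq u s f (Suc i) \<le> collapse_seq u s f i"
proof -
  have "f (Suc i) \<le> f i" by (rule young_step[OF assms])
  then consider "f (Suc i) = f i" | "f i = Suc (f (Suc i))" | "f (Suc i) + 2 \<le> f i"
    by linarith
  then show ?thesis
  proof cases
    case 1
    then show ?thesis
      using deficit_backward[OF 1, of u s] deficit_forward[OF 1, of u s]
        collapse_seq_add[OF assms, of u s i] collapse_seq_add[OF assms, of u s "Suc i"]
      by (auto simp: of_bool_def split: if_splits)
  next
    case 2
    \<comment> \<open>Of the adjacent entries \<open>f i\<close> and \<open>f (Suc i)\<close> one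
      becomes even after adding \<open>s\<close>; the deficit passes to the position beyond that
      entry.\<close>
    then have "deficit u s f (Suc i) \<Longrightarrow> deficit u s f i \<or> deficit u s f (Suc (Suc i))"
      by (cases i) (auto simp: deficit_def)
    then show ?thesis
      using 2 collapse_seq_add[OF assms, of u s i] collapse_seq_add[OF assms, of u s "Suc i"]
      by (auto simp: of_bool_def split: if_splits)
  next
    case 3
    then show ?thesis
      using collapse_seq_add[OF assms, of u s i] collapse_seq_add[OF assms, of u s "Suc i"]
      by (auto simp: of_bool_def split: if_splits)
  qed
qed

lemma deficit_tail:
  assumes "\<And>i. i \<ge> N \<Longrightarrow> f i = 0" and "k > N"
  shows "deficit u s f k \<longleftrightarrow> even s \<and> odd (u + (\<Sum>i<N. f i))"
proof -
  have "(\<Sum>i<k. f i) = (\<Sum>i<N. f i)"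
    using assms by (intro sum.mono_neutral_right) auto
  moreover have "f (k - 1) = 0" "f k = 0" using assms by auto
  ultimately show ?thesis using assms(2) by (auto simp: deficit_def)
qed

lemma young_collapse_seq:
  assumes "young f"
  shows "young (collapse_seq u s f)"
proof -
  obtain N where N: "\<And>i. i \<ge> N \<Longrightarrow> f i = 0"
    using assms by (auto simp: young_def)
  show ?thesis
  proof (rule youngI)
    show "collapse_seq u s f (Suc i) \<le> collapse_seq u s f i" for i
      by (rule collapse_seq_decreasing[OF assms])
    show "collapse_seq u s f i = 0" if "i \<ge> Suc N" for i
      using that N deficit_tail[of N f i u s] deficit_tail[of N f "Suc i" u s]
      by (auto simp: collapse_seq_def)
  qed
qed

text \<open>Lowering at a deficit repairs the parity. A wrong parity without deficit occurs only
  inside a run of entries \<open>c\<close> with \<open>c + s\<close> odd; then the parity is right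
  at both neighbouring positions, so both entries stay as they are and there is no descent.\<close>

lemma admissible_collapse_seq:
  assumes "young f" and "u \<le> 1"
  shows "admissible s (collapse_seq u s f)"
  unfolding admissible_def
proof (intro allI impI)
  fix k
  let ?c = "collapse_seq u s f"
  assume drop: "?c (Suc k) < ?c k"
  show "even ((\<Sum>i<Suc k. ?c i) + s * Suc k)"
  proof (rule ccontr)
    assume odd: "odd ((\<Sum>i<Suc k. ?c i) + s * Suc k)"
    have sum: "(\<Sum>i<Suc k. ?c i) + of_bool (deficit u s f (Suc k)) = (\<Sum>i<Suc k. f i) + u"
      by (rule sum_collapse_seq[OF assms])
    then have no: "\<not> deficit u s f (Suc k)"
    proof (intro notI)
      assume d: "deficit u s f (Suc k)"
      have "odd (u + (\<Sum>i<Suc k. f i) + s * Suc k)"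
        using d by (simp add: deficit_def del: sum.lessThan_Suc mult_Suc_right)
      moreover have "u + (\<Sum>i<Suc k. f i) = Suc (\<Sum>i<Suc k. ?c i)"
        using d sum by (simp del: sum.lessThan_Suc)
      ultimately show False
        using odd by (simp del: sum.lessThan_Suc mult_Suc_right)
    qed
    then have U: "odd (u + (\<Sum>i<Suc k. f i) + s * Suc k)"
      using odd sum no by (simp add: add.commute del: sum.lessThan_Suc mult_Suc_right)
    then have eq: "f k = f (Suc k)" "odd (f k + s)"
      using no unfolding deficit_def by simp_all
    with U have "\<not> deficit u s f k" "\<not> deficit u s f (Suc (Suc k))"
      by (auto simp: deficit_def)
    then show False
      using drop eq no by (simp add: collapse_seq_def)
  qed
qed

text \<open>Equality together with a deficit at \<open>Suc k\<close> gives \<open>r\<close> the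
  wrong parity there, hence no descent. The bounds at \<open>k\<close> and
  \<open>Suc (Suc k)\<close> then squeeze \<open>r k\<close>, \<open>f k\<close> and
  \<open>f (Suc k)\<close> to one value, so equality and deficit both move down to
  \<open>k\<close>.\<close>

lemma deficit_of_greater:
  assumes f: "young f" and r: "young r" "admissible s r"
    and le: "\<And>k. (\<Sum>i<k. r i) \<le> (\<Sum>i<k. f i) + u"
  shows "(\<Sum>i<k. r i) = (\<Sum>i<k. f i) + u \<Longrightarrow> \<not> deficit u s f k"
proof (induction k)
  case 0
  then show ?case by (simp add: deficit_def)
next
  case (Suc k)
  show ?case
  proof
    assume d: "deficit u s f (Suc k)"
    then have "odd ((\<Sum>i<Suc k. r i) + s * Suc k)"
      by (simp add: deficit_def Suc.prems add_ac del: sum.lessThan_Suc)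
    then have "\<not> r (Suc k) < r k"
      using r(2) by (auto simp: admissible_def)
    then have "r (Suc k) = r k"
      using young_step[OF r(1), of k] by simp
    then have "(\<Sum>i<k. r i) = (\<Sum>i<k. f i) + u \<and> f (Suc k) = f k"
      using Suc.prems le[of k] le[of "Suc (Suc k)"] young_step[OF f, of k] by simp
    then show False
      using Suc.IH deficit_backward[OF _ d] by simp
  qed
qed

lemma collapse_seq_greatest:
  assumes "young f" "u \<le> 1" "young r" "admissible s r"
    and "\<And>k. (\<Sum>i<k. r i) \<le> (\<Sum>i<k. f i) + u"
  shows "(\<Sum>i<k. r i) \<le> (\<Sum>i<k. collapse_seq u s f i)"
proof (cases "deficit u s f k")
  case True
  then have "(\<Sum>i<k. r i) \<noteq> (\<Sum>i<k. f i) + u"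
    using deficit_of_greater[OF assms(1,3,4,5), of k] by blast
  then show ?thesis
    using True assms(5)[of k] sum_collapse_seq[OF assms(1,2), of s k] by simp
next
  case False
  then show ?thesis
    using assms(5)[of k] sum_collapse_seq[OF assms(1,2), of s k] by simp
qed

section \<open>Adding a sequence with even entries\<close>

text \<open>All parities are kept, and equal adjacent entries of the sum force equal adjacent
  entries of \<open>f\<close>. The exception for runs can thus only disappear, and deficits can only
  be gained.\<close>

lemma deficit_add_even:
  assumes "young a" "young f" and "\<And>i. even (a i)" and "deficit u s f k"
  shows "deficit u s (\<lambda>i. a i + f i) k"
proof -
  have ev: "even (\<Sum>i<k. a i)" using assms(3) by (simp add: dvd_sum)
  show ?thesis
  proof (cases k)
    case 0
    then show ?thesis using assms(4) by (simp add: deficit_def)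
  next
    case (Suc m)
    have "a (Suc m) \<le> a m" "f (Suc m) \<le> f m"
      using assms young_step by auto
    then have "a m + f m = a (Suc m) + f (Suc m) \<Longrightarrow> f m = f (Suc m)" by linarith
    then show ?thesis
      using assms(3,4) ev Suc by (auto simp: deficit_def sum.distrib)
  qed
qed

section \<open>Conjugation at the corners of the diagram\<close>

text \<open>Both sides count the cells in the first \<open>m\<close> columns, once by columns and
  once by rows.\<close>

lemma sum_conjugate:
  fixes f g :: "nat \<Rightarrow> nat"
  assumes conj: "\<And>i j. j < f i \<longleftrightarrow> i < g j" and N: "\<And>i. i \<ge> N \<Longrightarrow> f i = 0"
  shows "(\<Sum>j<m. g j) = (\<Sum>i<N. min m (f i))"
proof (induction m)
  case 0
  then show ?case by simp
next
  case (Suc m)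
  have "g m \<le> N"
    using conj[of m N] N[of N] by force
  then have "{..<N} \<inter> {i. m < f i} = {..<g m}"
    using conj by auto
  then have "(\<Sum>i<N. of_bool (m < f i)) = g m"
    by simp
  moreover have "(\<Sum>i<N. min (Suc m) (f i)) = (\<Sum>i<N. min m (f i) + of_bool (m < f i))"
    by (rule sum.cong) (auto simp: min_def)
  ultimately show ?case
    using Suc by (simp add: sum.distrib)
qed

text \<open>The first \<open>i\<close> rows and the first \<open>j\<close> columns cover the diagram
  and meet in a full \<open>i\<close> by \<open>j\<close> rectangle.\<close>

lemma sum_conjugate_corner:
  fixes f g :: "nat \<Rightarrow> nat"
  assumes conj: "\<And>i j. j < f i \<longleftrightarrow> i < g j" and N: "\<And>i. i \<ge> N \<Longrightarrow> f i = 0"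
    and "\<And>k. k < i \<Longrightarrow> j \<le> f k" and "\<And>k. k \<ge> i \<Longrightarrow> f k \<le> j" and "i \<le> N"
  shows "(\<Sum>k<i. f k) + (\<Sum>k<j. g k) = (\<Sum>k<N. f k) + i * j"
proof -
  have split: "{..<N} = {..<i} \<union> {i..<N}" using assms(5) by auto
  have "(\<Sum>k<N. min j (f k)) = (\<Sum>k<i. min j (f k)) + (\<Sum>k=i..<N. min j (f k))"
    unfolding split by (rule sum.union_disjoint) auto
  also have "(\<Sum>k<i. min j (f k)) = (\<Sum>k<i. j)"
    using assms(3) by (intro sum.cong) auto
  also have "(\<Sum>k=i..<N. min j (f k)) = (\<Sum>k=i..<N. f k)"
    using assms(4) by (intro sum.cong) auto
  finally have "(\<Sum>k<j. g k) = i * j + (\<Sum>k=i..<N. f k)"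
    using sum_conjugate[OF conj N] by simp
  moreover have "(\<Sum>k<N. f k) = (\<Sum>k<i. f k) + (\<Sum>k=i..<N. f k)"
    unfolding split by (rule sum.union_disjoint) auto
  ultimately show ?thesis by simp
qed

text \<open>Each row changes by at most one cell. The disjuncts for the cell \<open>(i, j)\<close>:
  not the last of its row, the last one and not removed, the first free one and added.\<close>

lemma less_collapse_seq_iff:
  assumes "young f"
  shows "j < collapse_seq u s f i \<longleftrightarrow>
    Suc j < f i \<or>
    f i = Suc j \<and> \<not> (\<not> deficit u s f i \<and> deficit u s f (Suc i)) \<or>
    f i = j \<and> deficit u s f i \<and> \<not> deficit u s f (Suc i)"
  using collapse_seq_add[OF assms, of u s i] by (auto simp: of_bool_def split: if_splits)

text \<open>At a descent the exception for runs is void at \<open>Suc i\<close>. Given the wrong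
  parity there, the deficit at \<open>i\<close> is absent exactly when \<open>f i + s\<close> is
  odd. \<open>deficit_addable\<close> is the same at the start of a run.\<close>

lemma deficit_removable:
  assumes "f (Suc i) < f i"
  shows "\<not> deficit u s f i \<and> deficit u s f (Suc i) \<longleftrightarrow>
    odd (u + (\<Sum>k<Suc i. f k) + s * Suc i) \<and> odd (f i + s)"
  using assms unfolding deficit_def by (cases i) auto

lemma deficit_addable:
  assumes "i = 0 \<or> f i < f (i - 1)"
  shows "deficit u s f i \<and> \<not> deficit u s f (Suc i) \<longleftrightarrow>
    odd (u + (\<Sum>k<i. f k) + s * i) \<and> odd (f i + s)"
  using assms unfolding deficit_def by (cases i) auto

text \<open>Here \<open>(a, b)\<close> is a corner, \<open>n\<close> the size, and \<open>x\<close>,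
  \<open>y\<close> are the sums of the first \<open>a\<close> rows and \<open>b\<close> columns.
  Both sides say that \<open>a\<close> and \<open>b\<close> are odd if \<open>t = 0\<close>, and
  that they are even if \<open>t = 1\<close>.\<close>

lemma corner_parity:
  fixes t a b n x y :: nat
  assumes "t \<le> 1" and "x + y = n + a * b" and "even (x + (1 - t) * a)" and "odd (n + t)"
  shows "odd (t + x + t * a) \<and> odd (b + t) \<longleftrightarrow> odd (t + y + t * b) \<and> odd (a + t)"
proof -
  have "even (x + y) \<longleftrightarrow> even (n + a * b)" using assms(2) by simp
  moreover have "t = 0 \<or> t = 1" using assms(1) by linarith
  ultimately show ?thesis using assms(3,4) by auto
qed

text \<open>
  Only removable corners of the diagram are removed and only addable corners are added, so it
  suffices to compare parities at corners, where \<open>sum_conjugate_corner\<close> relates the partial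
  sums of \<open>f\<close> to those of its conjugate.
\<close>

lemma collapse_seq_conjugate:
  fixes f g :: "nat \<Rightarrow> nat"
  assumes f: "young f" and g: "young g"
    and conj: "\<And>i j. j < f i \<longleftrightarrow> i < g j"
    and N: "\<And>i. i \<ge> N \<Longrightarrow> f i = 0"
    and t: "t \<le> 1" and total: "odd ((\<Sum>i<N. f i) + t)"
    and adm: "admissible (1 - t) f"
  shows "j < collapse_seq t t f i \<longleftrightarrow> i < collapse_seq t t g j"
proof -
  let ?df = "deficit t t f" and ?dg = "deficit t t g"
  \<comment> \<open>The first two cases are the removable and the addable corners. In the other
    four, neither collapse changes the cell \<open>(i, j)\<close>.\<close>
  consider "f i = Suc j" "g j = Suc i" | "f i = j" "g j = i"
    | "Suc j < f i" | "f i = Suc j" "Suc i < g j" | "f i < j" "g j \<le> i" | "f i = j" "g j < i"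
    using conj[of j i] by linarith
  then show ?thesis
  proof cases
    case 1
    have fb: "f (Suc i) < f i" and gb: "g (Suc j) < g j"
      using 1 conj[of j "Suc i"] conj[of "Suc j" i] by auto
    have "(\<Sum>k<Suc i. f k) + (\<Sum>k<Suc j. g k) = (\<Sum>k<N. f k) + Suc i * Suc j"
    proof (rule sum_conjugate_corner[OF conj N])
      show "Suc i \<le> N" using 1 N[of i] by (cases "Suc i \<le> N") auto
      show "Suc j \<le> f k" if "k < Suc i" for k
        using youngD[OF f, of k i] that 1 by simp
      show "f k \<le> Suc j" if "Suc i \<le> k" for k
        using youngD[OF f, of i k] that 1 by simp
    qed
    moreover have "even ((\<Sum>k<Suc i. f k) + (1 - t) * Suc i)"
      using adm fb by (simp add: admissible_def)
    ultimately have "(odd (t + (\<Sum>k<Suc i. f k) + t * Suc i) \<and> odd (f i + t)) \<longleftrightarrow>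
        (odd (t + (\<Sum>k<Suc j. g k) + t * Suc j) \<and> odd (g j + t))"
      unfolding 1 by (rule corner_parity[OF t _ _ total])
    then show ?thesis
      using 1 deficit_removable[of f i t t] deficit_removable[of g j t t] fb gb
      by (auto simp: less_collapse_seq_iff[OF f] less_collapse_seq_iff[OF g])
  next
    case 2
    have fb: "i = 0 \<or> f i < f (i - 1)" and gb: "j = 0 \<or> g j < g (j - 1)"
      using 2 conj[of j "i - 1"] conj[of "j - 1" i] by auto
    have "i \<le> N"
    proof (rule ccontr)
      assume "\<not> i \<le> N"
      then have "N \<le> i - 1" "i \<noteq> 0" by auto
      then show False using fb N[of "i - 1"] by simp
    qed
    have "(\<Sum>k<i. f k) + (\<Sum>k<j. g k) = (\<Sum>k<N. f k) + i * j"
    proof (rule sum_conjugate_corner[OF conj N])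
      show "i \<le> N" by fact
      show "j \<le> f k" if "k < i" for k
        using youngD[OF f, of k i] that 2 by simp
      show "f k \<le> j" if "i \<le> k" for k
        using youngD[OF f, of i k] that 2 by simp
    qed
    moreover have "even ((\<Sum>k<i. f k) + (1 - t) * i)"
      using adm fb by (cases i) (auto simp: admissible_def)
    ultimately have "(odd (t + (\<Sum>k<i. f k) + t * i) \<and> odd (f i + t)) \<longleftrightarrow>
        (odd (t + (\<Sum>k<j. g k) + t * j) \<and> odd (g j + t))"
      unfolding 2 by (rule corner_parity[OF t _ _ total])
    then show ?thesis
      using 2 deficit_addable[of i f t t] deficit_addable[of j g t t] fb gb
      by (auto simp: less_collapse_seq_iff[OF f] less_collapse_seq_iff[OF g])
  next
    case 3
    then have "i < g j" "i < g (Suc j)" using conj[of j i] conj[of "Suc j" i] by auto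
    moreover have "g (Suc j) \<le> g j" by (rule young_step[OF g])
    \<comment> \<open>If the cell ends its column, the next column is equally long. Removing the
      cell would take a deficit at \<open>Suc j\<close> and none at \<open>j\<close>, against
      \<open>deficit_backward\<close>.\<close>
    ultimately have "Suc i < g j \<or> g j = Suc i \<and> g (Suc j) = g j" by linarith
    then show ?thesis
      using 3 deficit_backward[of g j t t]
      by (auto simp: less_collapse_seq_iff[OF f] less_collapse_seq_iff[OF g])
  next
    case 4
    then have "f (Suc i) = f i"
      using conj[of j "Suc i"] young_step[OF f, of i] by linarith
    then show ?thesis
      using 4 deficit_backward[of f i t t]
      by (auto simp: less_collapse_seq_iff[OF f] less_collapse_seq_iff[OF g])
  next
    case 5
    then obtain j' where j': "j = Suc j'" by (cases j) auto
    then have "g j' \<le> i" using 5 conj[of j' i] by linarith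
    then have "g j = i \<Longrightarrow> g (Suc j') = g j'"
      using young_step[OF g, of j'] j' by simp
    then show ?thesis
      using 5 j' deficit_forward[of g j' t t]
      by (auto simp: less_collapse_seq_iff[OF f] less_collapse_seq_iff[OF g])
  next
    case 6
    then obtain i' where i': "i = Suc i'" by (cases i) auto
    then have "f i' \<le> j" using 6 conj[of j i'] by linarith
    then have "f (Suc i') = f i'"
      using young_step[OF f, of i'] i' 6 by simp
    then show ?thesis
      using 6 i' deficit_forward[of f i' t t]
      by (auto simp: less_collapse_seq_iff[OF f] less_collapse_seq_iff[OF g])
  qed
qed

section \<open>Partitions as multisets and as sequences\<close>

definition partition_of :: "(nat \<Rightarrow> nat) \<Rightarrow> nat multiset" where
  "partition_of f = image_mset f (mset_set {i. f i \<noteq> 0})"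

text \<open>In a non-increasing list the entries above \<open>c\<close> form a prefix.\<close>

lemma less_length_filter_iff:
  fixes xs :: "nat list"
  assumes "sorted_wrt (\<ge>) xs"
  shows "i < length (filter ((<) c) xs) \<longleftrightarrow> i < length xs \<and> c < xs ! i"
  using assms
proof (induction xs arbitrary: i)
  case Nil
  then show ?case by simp
next
  case (Cons x xs)
  show ?case
  proof (cases "c < x")
    case True
    then show ?thesis using Cons by (cases i) auto
  next
    case False
    then have "filter ((<) c) xs = []"
      using Cons.prems by (auto simp: filter_empty_conv)
    then show ?thesis using False Cons by (cases i) (auto dest: nth_mem)
  qed
qed

text \<open>Expresses row lengths by column lengths, which unlike sorted lists are easy to compute
  for a multiset. Through \<open>part_eqI\<close> it is the main way to determine
  \<open>part\<close>.\<close>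

lemma less_part_iff: "c < part p i \<longleftrightarrow> i < size {#x \<in># p. c < x#}"
proof -
  let ?xs = "rev (sorted_list_of_multiset p)"
  have "sorted_wrt (\<ge>) ?xs" by (simp add: sorted_wrt_rev)
  moreover have m: "mset ?xs = p" by simp
  moreover have "{#x \<in># p. c < x#} = mset (filter ((<) c) ?xs)"
    unfolding mset_filter m by simp
  moreover have "length ?xs = size p" by (metis m size_mset)
  ultimately show ?thesis
    using less_length_filter_iff[of ?xs i c] by (auto simp: part_def simp del: mset_filter)
qed

lemma part_eqI:
  assumes "\<And>c i. c < f i \<longleftrightarrow> i < size {#x \<in># p. c < x#}"
  shows "part p = f"
proof
  fix i
  have "c < part p i \<longleftrightarrow> c < f i" for c
    using assms less_part_iff by simp
  then show "part p i = f i"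
    by (metis linorder_neqE_nat less_irrefl)
qed

lemma part_eq_0: "i \<ge> size p \<Longrightarrow> part p i = 0"
  by (simp add: part_def)

lemma young_part: "young (part p)"
proof (rule youngI)
  show "part p (Suc i) \<le> part p i" for i
    using less_part_iff[of "part p i" p "Suc i"] less_part_iff[of "part p i" p i]
    by linarith
qed (rule part_eq_0)

lemma sum_part:
  assumes "size p \<le> N"
  shows "(\<Sum>i<N. part p i) = sum_mset p"
proof -
  let ?xs = "rev (sorted_list_of_multiset p)"
  have m: "mset ?xs = p" by simp
  have l: "length ?xs = size p" by (metis m size_mset)
  have "(\<Sum>i<N. part p i) = (\<Sum>i<size p. part p i)"
    using assms by (intro sum.mono_neutral_right) (auto simp: part_eq_0)
  also have "\<dots> = (\<Sum>i<length ?xs. ?xs ! i)"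
    unfolding l by (intro sum.cong) (auto simp: part_def)
  also have "\<dots> = sum_list ?xs"
    by (metis sum_list_sum_nth atLeast0LessThan)
  also have "\<dots> = sum_mset p"
    by (metis m sum_mset_sum_list)
  finally show ?thesis .
qed

lemma size_filter_gt_Suc:
  "size {#x \<in># p. c < x#} = size {#x \<in># p. Suc c < x#} + count p (Suc c)"
  for p :: "nat multiset"
  by (induction p) (auto simp: less_Suc_eq)

lemma sum_filter_gt_Suc:
  "sum_mset {#x \<in># p. c < x#} = sum_mset {#x \<in># p. Suc c < x#} + Suc c * count p (Suc c)"
  for p :: "nat multiset"
  by (induction p) (auto simp: less_Suc_eq)

text \<open>Multiplicities of positive parts are differences of consecutive column lengths.\<close>

lemma partition_eqI:
  assumes "is_partition p" "is_partition q" and "part p = part q"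
  shows "p = q"
proof (rule multiset_eqI)
  have eq: "size {#x \<in># p. c < x#} = size {#x \<in># q. c < x#}" for c
    using less_part_iff[of c p] less_part_iff[of c q] assms(3)
    by (metis linorder_neqE_nat less_irrefl)
  show "count p x = count q x" for x
  proof (cases x)
    case 0
    then show ?thesis using assms(1,2) by (simp add: is_partition_def not_in_iff)
  next
    case (Suc c)
    then show ?thesis
      using eq[of c] eq[of "Suc c"] size_filter_gt_Suc[of c p] size_filter_gt_Suc[of c q] by simp
  qed
qed

lemma young_finite:
  assumes "young f"
  shows "finite {i. c < f i}"
proof -
  obtain N where "\<And>i. i \<ge> N \<Longrightarrow> f i = 0" using assms by (auto simp: young_def)
  then have "{i. c < f i} \<subseteq> {..<N}"
    by (auto simp: not_less[symmetric] intro: ccontr)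
  then show ?thesis using finite_subset by blast
qed

text \<open>By monotonicity the set is an initial segment of the indices.\<close>

lemma young_less_card_iff:
  assumes "young f"
  shows "i < card {i. c < f i} \<longleftrightarrow> c < f i"
proof -
  have fin: "finite {i. c < f i}" by (rule young_finite[OF assms])
  show ?thesis
  proof
    assume "c < f i"
    then have "{..i} \<subseteq> {i. c < f i}"
      using youngD[OF assms] by (auto intro: less_le_trans)
    then have "card {..i} \<le> card {i. c < f i}" by (rule card_mono[OF fin])
    then show "i < card {i. c < f i}" by simp
  next
    assume i: "i < card {i. c < f i}"
    show "c < f i"
    proof (rule ccontr)
      assume n: "\<not> c < f i"
      have "{i. c < f i} \<subseteq> {..<i}"
      proof
        fix k assume "k \<in> {i. c < f i}"
        then show "k \<in> {..<i}" using n youngD[OF assms, of i k] by (cases "i \<le> k") auto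
      qed
      then have "card {i. c < f i} \<le> card {..<i}" by (intro card_mono) auto
      then show False using i by simp
    qed
  qed
qed

lemma size_filter_partition_of:
  assumes "young f"
  shows "size {#x \<in># partition_of f. c < x#} = card {i. c < f i}"
proof -
  have "finite {i. f i \<noteq> 0}" using young_finite[OF assms, of 0] by simp
  moreover have "{i. f i \<noteq> 0 \<and> c < f i} = {i. c < f i}" by auto
  ultimately show ?thesis
    by (simp add: partition_of_def filter_mset_image_mset)
qed

lemma part_partition_of: "young f \<Longrightarrow> part (partition_of f) = f"
  by (rule part_eqI) (simp add: size_filter_partition_of young_less_card_iff)

lemma is_partition_partition_of: "young f \<Longrightarrow> is_partition (partition_of f)"
  using young_finite[of f 0] by (auto simp: is_partition_def partition_of_def)

lemma partition_of_eqI: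
  assumes "is_partition p" and "part p = f"
  shows "partition_of f = p"
  using assms partition_eqI[OF is_partition_partition_of assms(1)] part_partition_of young_part
  by metis

lemma transpose_eq_partition_of:
  "transpose_partition p = partition_of (\<lambda>j. size {#x \<in># p. j < x#})"
proof -
  have "{j. size {#x \<in># p. j < x#} \<noteq> 0} = {..<part p 0}"
    by (simp only: lessThan_def less_part_iff neq0_conv)
  then show ?thesis by (simp add: transpose_partition_def partition_of_def)
qed

lemma young_conjugate: "young (\<lambda>j. size {#x \<in># p. j < x#})"
proof (rule youngI)
  show "size {#x \<in># p. Suc i < x#} \<le> size {#x \<in># p. i < x#}" for i
    using size_filter_gt_Suc[of i p] by simp
  show "size {#x \<in># p. i < x#} = 0" if "i \<ge> part p 0" for i
    using less_part_iff[of i p 0] that by simp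
qed

lemma part_transpose: "part (transpose_partition p) j = size {#x \<in># p. j < x#}"
  by (simp add: transpose_eq_partition_of part_partition_of young_conjugate)

lemma is_partition_transpose: "is_partition (transpose_partition p)"
  by (simp add: transpose_eq_partition_of is_partition_partition_of young_conjugate)

lemma less_part_transpose_iff: "i < part (transpose_partition p) j \<longleftrightarrow> j < part p i"
  by (simp add: part_transpose less_part_iff)

lemma young_add:
  assumes "young f" "young g"
  shows "young (\<lambda>i. f i + g i)"
proof -
  obtain M N where "\<And>i. i \<ge> M \<Longrightarrow> f i = 0" "\<And>i. i \<ge> N \<Longrightarrow> g i = 0"
    using assms by (auto simp: young_def)
  then show ?thesis
    using assms by (intro youngI[of _ "max M N"]) (auto intro: add_mono young_step)
qed

lemma partition_part_eq_0_iff: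
  assumes "is_partition p"
  shows "part p i = 0 \<longleftrightarrow> size p \<le> i"
proof -
  have "{#x \<in># p. 0 < x#} = p"
    using assms by (intro filter_mset_eq_conv[THEN iffD2]) (auto simp: is_partition_def intro: gr0I)
  then show ?thesis using less_part_iff[of 0 p i] by auto
qed

lemma partwise_sum_eq_partition_of:
  assumes "is_partition p" "is_partition q"
  shows "partwise_sum p q = partition_of (\<lambda>i. part p i + part q i)"
proof -
  have "{i. part p i + part q i \<noteq> 0} = {..<max (size p) (size q)}"
    using partition_part_eq_0_iff[OF assms(1)] partition_part_eq_0_iff[OF assms(2)]
    by (auto simp: less_max_iff_disj not_le)
  then show ?thesis by (simp add: partwise_sum_def partition_of_def)
qed

lemma part_replicate_mset: "part (replicate_mset b m) = (\<lambda>j. if j < b then m else 0)"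
proof (rule part_eqI)
  fix c i
  have "{#x \<in># replicate_mset b m. c < x#} = (if c < m then replicate_mset b m else {#})"
    by (induction b) auto
  then show "c < (if i < b then m else 0) \<longleftrightarrow> i < size {#x \<in># replicate_mset b m. c < x#}"
    by simp
qed

text \<open>Inserting \<open>m\<close> rows of length \<open>b\<close> lengthens each of the first
  \<open>b\<close> columns by \<open>m\<close>.\<close>

lemma transpose_union_replicate:
  assumes "m > 0"
  shows "transpose_partition (replicate_mset m b + p) =
    partwise_sum (replicate_mset b m) (transpose_partition p)"
proof -
  have "{#x \<in># replicate_mset m b. j < x#} = (if j < b then replicate_mset m b else {#})" for j
    by (induction m) auto
  moreover have "part (replicate_mset b m) = (\<lambda>j. if j < b then m else 0)"
    by (rule part_replicate_mset)
  moreover have "is_partition (replicate_mset b m)"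
    using assms by (simp add: is_partition_def)
  ultimately show ?thesis
    by (auto simp: partwise_sum_eq_partition_of is_partition_transpose part_transpose
        transpose_eq_partition_of[of "_ + _"] intro!: arg_cong[of _ _ partition_of])
qed

lemma part_0_ge:
  assumes "x \<in># p"
  shows "x \<le> part p 0"
proof (rule ccontr)
  assume "\<not> x \<le> part p 0"
  then have "x \<in># {#x \<in># p. part p 0 < x#}" using assms by simp
  then have "{#x \<in># p. part p 0 < x#} \<noteq> {#}" by force
  then have "0 < size {#x \<in># p. part p 0 < x#}" by (simp only: nonempty_has_size)
  then show False by (simp flip: less_part_iff)
qed

lemma part_mem:
  assumes "i < size p"
  shows "part p i \<in># p"
proof -
  let ?xs = "rev (sorted_list_of_multiset p)"
  have m: "mset ?xs = p" by simp
  have "length ?xs = size p" by (metis m size_mset)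
  then have "?xs ! i \<in> set ?xs" using assms by (intro nth_mem) simp
  then show ?thesis using assms by (simp add: part_def)
qed

lemma part_raise_first: "part (raise_first p) i = part p i + of_bool (i = 0)"
proof -
  let ?m = "part p 0"
  have "part (raise_first p) = (\<lambda>i. part p i + of_bool (i = 0))"
  proof (rule part_eqI)
    fix c i
    \<comment> \<open>Only the column with index \<open>part p 0\<close>, empty so far, gains a
      cell.\<close>
    have "size {#x \<in># raise_first p. c < x#} = size {#x \<in># p. c < x#} + of_bool (c = ?m)"
    proof (cases "p = {#}")
      case True
      then show ?thesis by (simp add: raise_first_def part_def)
    next
      case False
      then obtain p' where p': "p = add_mset ?m p'"
        using part_mem[of 0 p] by (auto simp: nonempty_has_size dest: multi_member_split)
      then have "raise_first p = add_mset (?m + 1) p'"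
        unfolding raise_first_def by (metis add_mset_remove_trivial)
      then show ?thesis by (subst (2) p') auto
    qed
    moreover have "c < x + of_bool (i = 0) \<longleftrightarrow> i < n + of_bool (c = ?m)"
      if "c < ?m \<longleftrightarrow> 0 < n" "c < x \<longleftrightarrow> i < n" "i = 0 \<Longrightarrow> x = ?m" for n x :: nat
      using that by (cases "i = 0") auto
    ultimately show "c < part p i + of_bool (i = 0) \<longleftrightarrow> i < size {#x \<in># raise_first p. c < x#}"
      using less_part_iff[of c p 0] less_part_iff[of c p i] by metis
  qed
  then show ?thesis by simp
qed

lemma part_lower_last:
  assumes "is_partition p"
  shows "part (lower_last p) i = part p i - of_bool (Suc i = size p)"
proof (cases "p = {#}")
  case True
  then show ?thesis by (simp add: lower_last_def part_def)
next
  case False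
  define m where "m = part p (size p - 1)"
  have "m > 0"
    using partition_part_eq_0_iff[OF assms, of "size p - 1"] False by (auto simp: m_def nonempty_has_size)
  have size: "size p > 0" using False by (simp add: nonempty_has_size)
  obtain p' where p': "p = add_mset m p'"
    using part_mem[of "size p - 1" p] size by (auto simp: m_def dest: multi_member_split)
  have ll: "lower_last p = {#x \<in># add_mset (m - 1) p'. x \<noteq> 0#}"
    unfolding lower_last_def Let_def m_def[symmetric] by (subst p') simp
  have "part (lower_last p) = (\<lambda>i. part p i - of_bool (Suc i = size p))"
  proof (rule part_eqI)
    fix c i
    have "{#x \<in># lower_last p. c < x#} = {#x \<in># add_mset (m - 1) p'. c < x#}"
      unfolding ll filter_filter_mset by (rule filter_mset_cong) auto
    moreover have "{#x \<in># p. c < x#} = {#x \<in># add_mset m p'. c < x#}"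
      using p' by simp
    ultimately have s: "size {#x \<in># lower_last p. c < x#} + of_bool (Suc c = m) = size {#x \<in># p. c < x#}"
      using \<open>m > 0\<close> by auto
    \<comment> \<open>The column that loses a cell meets every row, so the cell is lost in the last
      row.\<close>
    have full: "size {#x \<in># p. c < x#} = size p" if "Suc c = m"
    proof -
      have "size p - 1 < size {#x \<in># p. c < x#}"
        using less_part_iff[of c p "size p - 1"] that by (simp add: m_def)
      moreover have "size {#x \<in># p. c < x#} \<le> size p" by (rule size_filter_mset_lesseq)
      ultimately show ?thesis by linarith
    qed
    show "c < part p i - of_bool (Suc i = size p) \<longleftrightarrow> i < size {#x \<in># lower_last p. c < x#}"
    proof (cases "Suc i = size p")
      case True
      then have "part p i = m" by (simp add: m_def flip: True)
      then show ?thesis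
        using True s full less_part_iff[of c p i] by (cases "Suc c = m") auto
    next
      case False
      then show ?thesis
        using s full less_part_iff[of c p i] by (cases "Suc c = m") auto
    qed
  qed
  then show ?thesis by simp
qed

section \<open>Types as parity conditions on partial sums\<close>

lemma sum_filter_gt_eq_sum_part:
  "sum_mset {#x \<in># p. c < x#} = (\<Sum>i<size {#x \<in># p. c < x#}. part p i)"
proof -
  let ?q = "{#x \<in># p. c < x#}"
  have "part ?q = (\<lambda>i. if c < part p i then part p i else 0)"
  proof (rule part_eqI)
    fix e i
    have "{#x \<in># ?q. e < x#} = {#x \<in># p. max c e < x#}"
      unfolding filter_filter_mset by (rule filter_mset_cong) auto
    then show "e < (if c < part p i then part p i else 0) \<longleftrightarrow> i < size {#x \<in># ?q. e < x#}"
      using less_part_iff[of "max c e" p i] by auto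
  qed
  then have "(\<Sum>i<size ?q. part ?q i) = (\<Sum>i<size ?q. part p i)"
    by (intro sum.cong) (auto simp: less_part_iff)
  then show ?thesis using sum_part[of ?q "size ?q"] by simp
qed

text \<open>The sum \<open>?h c\<close> of \<open>x + s\<close> over the parts \<open>x > c\<close>
  changes by \<open>(Suc c + s) * count p (Suc c)\<close> from \<open>Suc c\<close> to
  \<open>c\<close> and vanishes for large \<open>c\<close>, so the multiplicity conditions say that
  every \<open>?h c\<close> is even. The nonzero numbers of parts above some \<open>c\<close> are
  exactly the positions of strict descents.\<close>

lemma even_count_iff_admissible:
  assumes "is_partition p"
  shows "(\<forall>k. k \<in># p \<and> odd (k + s) \<longrightarrow> even (count p k)) \<longleftrightarrow> admissible s (part p)"
    (is "?L \<longleftrightarrow> _")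
proof -
  let ?n = "\<lambda>c. size {#x \<in># p. c < x#}"
  let ?h = "\<lambda>c. sum_mset {#x \<in># p. c < x#} + s * ?n c"
  have step: "?h c = ?h (Suc c) + (Suc c + s) * count p (Suc c)" for c
    using sum_filter_gt_Suc[of c p] size_filter_gt_Suc[of c p] by (simp add: algebra_simps)
  have "?L \<longleftrightarrow> (\<forall>c. even (?h c))"
  proof
    assume L: ?L
    have ev: "even ((Suc c + s) * count p (Suc c))" for c
      using L by (cases "Suc c \<in># p") (auto simp: not_in_iff)
    show "\<forall>c. even (?h c)"
    proof
      fix c
      show "even (?h c)"
      proof (induction "part p 0 - c" arbitrary: c)
        case 0
        then have "{#x \<in># p. c < x#} = {#}"
          using part_0_ge[of _ p] by (intro filter_mset_eq_conv[THEN iffD2]) fastforce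
        then show ?case by (simp only: size_empty sum_mset.empty mult_0_right add_0 dvd_0_right)
      next
        case (Suc m)
        then have "even (?h (Suc c))" by simp
        then show ?case using ev[of c] step[of c] by (metis even_add)
      qed
    qed
  next
    assume H: "\<forall>c. even (?h c)"
    show ?L
    proof (intro allI impI)
      fix k assume k: "k \<in># p \<and> odd (k + s)"
      then obtain c where c: "k = Suc c" using assms by (cases k) (auto simp: is_partition_def)
      have "even ((Suc c + s) * count p (Suc c))" using H step[of c] by (metis even_add)
      then show "even (count p k)" using k c by simp
    qed
  qed
  also have "\<dots> \<longleftrightarrow> (\<forall>c. even ((\<Sum>i<?n c. part p i) + s * ?n c))"
    by (simp add: sum_filter_gt_eq_sum_part)
  also have "\<dots> \<longleftrightarrow> admissible s (part p)"
  proof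
    assume H: "\<forall>c. even ((\<Sum>i<?n c. part p i) + s * ?n c)"
    show "admissible s (part p)"
      unfolding admissible_def
    proof (intro allI impI)
      fix k assume "part p (Suc k) < part p k"
      then have "?n (part p (Suc k)) = Suc k"
        using less_part_iff[of "part p (Suc k)" p k] less_part_iff[of "part p (Suc k)" p "Suc k"]
        by linarith
      then show "even ((\<Sum>i<Suc k. part p i) + s * Suc k)" using H by metis
    qed
  next
    assume A: "admissible s (part p)"
    show "\<forall>c. even ((\<Sum>i<?n c. part p i) + s * ?n c)"
    proof
      fix c
      show "even ((\<Sum>i<?n c. part p i) + s * ?n c)"
      proof (cases "?n c")
        case (Suc k)
        then have "part p (Suc k) < part p k"
          using less_part_iff[of c p k] less_part_iff[of c p "Suc k"] by simp
        then show ?thesis using A unfolding Suc admissible_def by blast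
      next
        case 0
        then show ?thesis by (simp only: lessThan_0 sum.empty mult_0_right add_0 dvd_0_right)
      qed
    qed
  qed
  finally show ?thesis .
qed

text \<open>The parts \<open>k\<close> with \<open>k + parity_offset X\<close> odd are those that
  type \<open>X\<close> requires to have even multiplicity.\<close>

fun parity_offset :: "partition_type \<Rightarrow> nat" where
  "parity_offset Type_C = 0"
| "parity_offset _ = 1"

lemma of_type_iff:
  "of_type X p \<longleftrightarrow> is_partition p \<and> (odd (sum_mset p) \<longleftrightarrow> X = Type_B) \<and>
     admissible (parity_offset X) (part p)"
  using even_count_iff_admissible[of p 0] even_count_iff_admissible[of p 1] by (cases X) auto

section \<open>The collapse of a partition\<close>

lemma dominated_antisym:
  assumes "is_partition p" "is_partition q" "dominated p q" "dominated q p"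
  shows "p = q"
proof (rule partition_eqI[OF assms(1,2)])
  have eq: "(\<Sum>i<k. part p i) = (\<Sum>i<k. part q i)" for k
    using assms(3,4) by (simp add: dominated_def order.antisym)
  have "part p i = part q i" for i
    using eq[of i] eq[of "Suc i"] by simp
  then show "part p = part q" by auto
qed

text \<open>A greatest element is maximal by antisymmetry, and any maximal element lies below it and
  hence equals it.\<close>

lemma collapse_eqI:
  assumes "of_type X q" "dominated q p" and "\<And>r. of_type X r \<Longrightarrow> dominated r p \<Longrightarrow> dominated r q"
  shows "collapse X p = q"
  unfolding collapse_def
proof (rule the_equality)
  have part: "of_type X r \<Longrightarrow> is_partition r" for r by (simp add: of_type_iff)
  show "of_type X q \<and> dominated q p \<and> (\<forall>r. of_type X r \<and> dominated r p \<and> dominated q r \<longrightarrow> r = q)"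
    using assms part dominated_antisym by blast
  show "q' = q" if "of_type X q' \<and> dominated q' p \<and>
      (\<forall>r. of_type X r \<and> dominated r p \<and> dominated q' r \<longrightarrow> r = q')" for q'
    using that assms by blast
qed

text \<open>The partition \<open>p\<close> need not have the parts \<open>f\<close>: its partial
  sums may lie anywhere between those of the collapsed sequence and those of \<open>f\<close> raised
  by \<open>u\<close>. This leeway covers \<open>p^-\<close>, \<open>p^+\<close> and the sum of an
  even partition with a collapsed one.\<close>

lemma collapse_eq_collapse_seq:
  assumes f: "young f" and u: "u \<le> 1" and s: "s = parity_offset X"
    and parity: "odd (sum_mset p) \<longleftrightarrow> X = Type_B"
    and lower: "\<And>k. (\<Sum>i<k. collapse_seq u s f i) \<le> (\<Sum>i<k. part p i)"
    and upper: "\<And>k. (\<Sum>i<k. part p i) \<le> (\<Sum>i<k. f i) + u"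
    and total: "\<And>k. k \<ge> N \<Longrightarrow> (\<Sum>i<k. collapse_seq u s f i) = (\<Sum>i<k. part p i)"
  shows "collapse X p = partition_of (collapse_seq u s f)"
proof (rule collapse_eqI)
  let ?q = "partition_of (collapse_seq u s f)"
  have y: "young (collapse_seq u s f)" by (rule young_collapse_seq[OF f])
  have q: "part ?q = collapse_seq u s f" by (rule part_partition_of[OF y])
  let ?M = "Max {N, size p, size ?q}"
  have "sum_mset ?q = (\<Sum>i<?M. part ?q i)" by (rule sum_part[symmetric]) simp
  also have "\<dots> = (\<Sum>i<?M. part p i)" unfolding q by (rule total) simp
  also have "\<dots> = sum_mset p" by (rule sum_part) simp
  finally have sum: "sum_mset ?q = sum_mset p" .
  show "of_type X ?q"
    using is_partition_partition_of[OF y] admissible_collapse_seq[OF f u, of s] parity sum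
    unfolding of_type_iff q s[symmetric] by simp
  show "dominated ?q p"
    using sum lower by (simp add: dominated_def q)
  show "dominated r ?q" if r: "of_type X r" "dominated r p" for r
  proof -
    have "(\<Sum>i<k. part r i) \<le> (\<Sum>i<k. f i) + u" for k
      using r(2) upper[of k] by (auto simp: dominated_def intro: order.trans)
    then have "(\<Sum>i<k. part r i) \<le> (\<Sum>i<k. collapse_seq u s f i)" for k
      using r(1) s by (intro collapse_seq_greatest[OF f u young_part]) (auto simp: of_type_iff)
    then show ?thesis using r(2) sum by (simp add: dominated_def q)
  qed
qed

lemma part_partwise_sum:
  assumes "is_partition p" "is_partition q"
  shows "part (partwise_sum p q) = (\<lambda>i. part p i + part q i)"
  using assms by (simp add: partwise_sum_eq_partition_of part_partition_of young_add young_part)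

lemma sum_mset_partwise_sum:
  assumes "is_partition p" "is_partition q"
  shows "sum_mset (partwise_sum p q) = sum_mset p + sum_mset q"
proof -
  let ?M = "Max {size p, size q, size (partwise_sum p q)}"
  have "sum_mset (partwise_sum p q) = (\<Sum>i<?M. part (partwise_sum p q) i)"
    by (rule sum_part[symmetric]) simp
  also have "\<dots> = (\<Sum>i<?M. part p i) + (\<Sum>i<?M. part q i)"
    by (simp only: part_partwise_sum[OF assms] sum.distrib)
  also have "(\<Sum>i<?M. part p i) = sum_mset p" by (rule sum_part) simp
  also have "(\<Sum>i<?M. part q i) = sum_mset q" by (rule sum_part) simp
  finally show ?thesis .
qed

lemma sum_mset_transpose: "sum_mset (transpose_partition p) = sum_mset p"
proof -
  let ?q = "transpose_partition p"
  let ?M = "max (part p 0) (size ?q)"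
  have "sum_mset ?q = (\<Sum>j<?M. part ?q j)"
    by (rule sum_part[symmetric]) simp
  also have "\<dots> = (\<Sum>i<size p. min ?M (part p i))"
    by (rule sum_conjugate) (simp_all add: less_part_transpose_iff part_eq_0)
  also have "\<dots> = (\<Sum>i<size p. part p i)"
    by (intro sum.cong refl min_absorb2 max.coboundedI1 youngD[OF young_part]) simp
  also have "\<dots> = sum_mset p" by (rule sum_part) simp
  finally show ?thesis .
qed

lemma transpose_partition_of:
  assumes "young f" "young g" and "\<And>i j. j < f i \<longleftrightarrow> i < g j"
  shows "transpose_partition (partition_of f) = partition_of g"
proof (rule partition_of_eqI[symmetric, OF is_partition_transpose])
  show "part (transpose_partition (partition_of f)) = g"
    by (rule part_eqI) (simp add: assms part_partition_of less_part_transpose_iff flip: less_part_iff)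
qed

text \<open>The case \<open>t = 0\<close> serves \<open>p\<close> of type B collapsed to type C, and
  \<open>t = 1\<close> the reverse; the parity offset of \<open>p\<close> is the opposite
  \<open>1 - t\<close> of the one used in the collapse.\<close>

lemma transpose_collapse_seq:
  assumes "t \<le> 1" and "odd (sum_mset p + t)" and "admissible (1 - t) (part p)"
  shows "transpose_partition (partition_of (collapse_seq t t (part p))) =
    partition_of (collapse_seq t t (part (transpose_partition p)))"
proof (rule transpose_partition_of)
  show "j < collapse_seq t t (part p) i \<longleftrightarrow> i < collapse_seq t t (part (transpose_partition p)) j"
    for i j
    using assms
    by (intro collapse_seq_conjugate[where N = "size p"])
      (auto simp: young_part less_part_transpose_iff part_eq_0 sum_part)
qed (simp_all add: young_collapse_seq young_part)

lemma deficit_part_tail: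
  "k > size p \<Longrightarrow> deficit u s (part p) k \<longleftrightarrow> even s \<and> odd (u + sum_mset p)"
  using deficit_tail[of "size p" "part p" k u s] by (simp add: part_eq_0 sum_part)

lemma sum_part_lower_last:
  assumes "is_partition p" "p \<noteq> {#}"
  shows "(\<Sum>i<k. part (lower_last p) i) + of_bool (size p \<le> k) = (\<Sum>i<k. part p i)"
proof (induction k)
  case 0
  then show ?case using assms(2) by simp
next
  case (Suc k)
  \<comment> \<open>The last part is positive, so lowering it is not truncated.\<close>
  have "Suc k = size p \<Longrightarrow> part p k \<noteq> 0"
    using partition_part_eq_0_iff[OF assms(1), of k] by simp
  then show ?case
    using Suc by (auto simp: part_lower_last[OF assms(1)] of_bool_def split: if_splits)
qed

text \<open>As the size is odd and \<open>s = 0\<close>, every position from \<open>size p\<close>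
  on has a deficit. The collapse of \<open>p\<close> thus loses one cell in total, just as
  \<open>p^-\<close> does.\<close>

lemma collapse_lower_last:
  assumes "is_partition p" and "odd (sum_mset p)"
  shows "collapse Type_C (lower_last p) = partition_of (collapse_seq 0 0 (part p))"
proof (rule collapse_eq_collapse_seq)
  have ne: "p \<noteq> {#}" using assms(2) by auto
  note sum = sum_part_lower_last[OF assms(1) ne]
  have coll: "(\<Sum>i<k. collapse_seq 0 0 (part p) i) + of_bool (deficit 0 0 (part p) k) =
      (\<Sum>i<k. part p i)" for k
    using sum_collapse_seq[OF young_part, of 0 0 p k] by simp
  have deficit: "deficit 0 0 (part p) k" if "size p \<le> k" for k
    using that assms(2) ne by (auto simp: deficit_def sum_part part_eq_0)
  show "(\<Sum>i<k. collapse_seq 0 0 (part p) i) \<le> (\<Sum>i<k. part (lower_last p) i)" for k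
    using coll[of k] sum[of k] deficit[of k] by (cases "size p \<le> k") auto
  show "(\<Sum>i<k. collapse_seq 0 0 (part p) i) = (\<Sum>i<k. part (lower_last p) i)"
    if "size p \<le> k" for k
    using coll[of k] sum[of k] deficit[of k] that by auto
  show "(\<Sum>i<k. part (lower_last p) i) \<le> (\<Sum>i<k. part p i) + 0" for k
    using sum[of k] by linarith
  let ?k = "max (size p) (size (lower_last p))"
  have "sum_mset (lower_last p) + 1 = sum_mset p"
    using sum[of ?k] sum_part[of p ?k] sum_part[of "lower_last p" ?k] by simp
  then show "odd (sum_mset (lower_last p)) \<longleftrightarrow> Type_C = Type_B"
    using assms(2) by (metis even_plus_one_iff partition_type.distinct(1))
qed (simp_all add: young_part)

lemma sum_part_raise_first:
  "(\<Sum>i<k. part (raise_first p) i) = (\<Sum>i<k. part p i) + of_bool (k > 0)"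
  by (induction k) (auto simp: part_raise_first)

text \<open>The offset \<open>u = 1\<close> raises every partial sum, and the deficit at
  \<open>0\<close> cancels this at \<open>0\<close> only, which matches the effect of
  \<open>raise_first\<close>. There are no deficits past the support, because \<open>s\<close> is
  odd.\<close>

lemma collapse_raise_first:
  assumes "even (sum_mset p)"
  shows "collapse Type_B (raise_first p) = partition_of (collapse_seq 1 1 (part p))"
proof (rule collapse_eq_collapse_seq)
  note sum = sum_part_raise_first[of p]
  have coll: "(\<Sum>i<k. collapse_seq 1 1 (part p) i) + of_bool (deficit 1 1 (part p) k) =
      (\<Sum>i<k. part p i) + 1" for k
    by (rule sum_collapse_seq[OF young_part]) simp
  show "(\<Sum>i<k. collapse_seq 1 1 (part p) i) \<le> (\<Sum>i<k. part (raise_first p) i)" for k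
    using coll[of k] sum[of k] by (cases "k = 0") auto
  show "(\<Sum>i<k. collapse_seq 1 1 (part p) i) = (\<Sum>i<k. part (raise_first p) i)"
    if "Suc (size p) \<le> k" for k
    using coll[of k] sum[of k] deficit_part_tail[of p k 1 1] that by simp
  show "(\<Sum>i<k. part (raise_first p) i) \<le> (\<Sum>i<k. part p i) + 1" for k
    using sum[of k] by (auto simp: of_bool_def)
  let ?k = "Max {1, size p, size (raise_first p)}"
  have "sum_mset (raise_first p) = sum_mset p + 1"
    using sum[of ?k] sum_part[of p ?k] sum_part[of "raise_first p" ?k] by (simp add: less_max_iff_disj)
  then show "odd (sum_mset (raise_first p)) \<longleftrightarrow> Type_B = Type_B"
    using assms by simp
qed (simp_all add: young_part)

lemma collapse_Type_D:
  assumes "even (sum_mset p)"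
  shows "collapse Type_D p = partition_of (collapse_seq 0 1 (part p))"
proof (rule collapse_eq_collapse_seq)
  have coll: "(\<Sum>i<k. collapse_seq 0 1 (part p) i) + of_bool (deficit 0 1 (part p) k) =
      (\<Sum>i<k. part p i)" for k
    using sum_collapse_seq[OF young_part, of 0 1 p k] by simp
  show "(\<Sum>i<k. collapse_seq 0 1 (part p) i) \<le> (\<Sum>i<k. part p i)" for k
    using coll[of k] by linarith
  show "(\<Sum>i<k. collapse_seq 0 1 (part p) i) = (\<Sum>i<k. part p i)" if "Suc (size p) \<le> k" for k
    using coll[of k] deficit_part_tail[of p k 0 1] that by simp
qed (use assms in \<open>simp_all add: young_part\<close>)

text \<open>By \<open>deficit_add_even\<close> every deficit of \<open>q\<close> is one of
  \<open>a + q\<close>. The partial sums of \<open>a\<close> plus the collapsed \<open>q\<close>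
  hence stay above those of the collapsed \<open>a + q\<close>, and
  \<open>collapse_eq_collapse_seq\<close> applies.\<close>

lemma collapse_partwise_sum_even:
  assumes part: "is_partition a" and even: "\<And>i. even (part a i)"
    and u: "u \<le> 1" and s: "s = parity_offset X"
    and parity: "odd s \<Longrightarrow> odd (sum_mset q + u) \<longleftrightarrow> X = Type_B"
  shows "collapse X (partwise_sum a (partition_of (collapse_seq u s (part q)))) =
    partition_of (collapse_seq u s (\<lambda>i. part a i + part q i))"
proof (rule collapse_eq_collapse_seq[OF young_add[OF young_part young_part] u s])
  let ?c = "partition_of (collapse_seq u s (part q))" and ?f = "\<lambda>i. part a i + part q i"
  have yc: "young (collapse_seq u s (part q))" by (simp add: young_collapse_seq young_part)
  note pc = is_partition_partition_of[OF yc]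
  have p: "part (partwise_sum a ?c) = (\<lambda>i. part a i + collapse_seq u s (part q) i)"
    by (simp add: part_partwise_sum[OF part pc] part_partition_of[OF yc])
  have yf: "young ?f" by (rule young_add[OF young_part young_part])
  have cq: "(\<Sum>i<k. collapse_seq u s (part q) i) + of_bool (deficit u s (part q) k) =
      (\<Sum>i<k. part q i) + u" for k
    by (rule sum_collapse_seq[OF young_part u])
  have cf: "(\<Sum>i<k. collapse_seq u s ?f i) + of_bool (deficit u s ?f k) =
      (\<Sum>i<k. part a i) + (\<Sum>i<k. part q i) + u" for k
    using sum_collapse_seq[OF yf u, of s k] by (simp add: sum.distrib)
  have sa: "even (\<Sum>i<k. part a i)" for k using even by (simp add: dvd_sum)
  show "(\<Sum>i<k. collapse_seq u s ?f i) \<le> (\<Sum>i<k. part (partwise_sum a ?c) i)" for k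
    using cq[of k] cf[of k] deficit_add_even[OF young_part young_part even, of u s q k]
    by (cases "deficit u s (part q) k") (auto simp: p sum.distrib)
  show "(\<Sum>i<k. part (partwise_sum a ?c) i) \<le> (\<Sum>i<k. ?f i) + u" for k
    using cq[of k] by (auto simp: p sum.distrib)
  let ?N = "max (size a) (size q)"
  have tail: "deficit u s ?f k \<longleftrightarrow> deficit u s (part q) k" if "k > ?N" for k
    using that sa[of ?N] deficit_tail[of ?N ?f k u s] deficit_part_tail[of q k u s]
    by (simp add: part_eq_0 sum.distrib sum_part)
  show "(\<Sum>i<k. collapse_seq u s ?f i) = (\<Sum>i<k. part (partwise_sum a ?c) i)"
    if "Suc ?N \<le> k" for k
  proof -
    have "deficit u s ?f k \<longleftrightarrow> deficit u s (part q) k" by (rule tail) (use that in linarith)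
    then show ?thesis using cq[of k] cf[of k] by (simp add: p sum.distrib)
  qed
  let ?M = "Suc (max (size q) (size ?c))"
  have "sum_mset ?c = (\<Sum>i<?M. part ?c i)" by (rule sum_part[symmetric]) simp
  \<comment> \<open>The size is read off past the support of both sequences, where the deficit no
    longer depends on the position. For even \<open>s\<close> it makes the size even, as type C
    demands.\<close>
  then have sc: "sum_mset ?c + of_bool (even s \<and> odd (u + sum_mset q)) = sum_mset q + u"
    using cq[of ?M] sum_part[of q ?M] deficit_part_tail[of q ?M u s]
    by (simp add: part_partition_of[OF yc] del: sum.lessThan_Suc)
  have "even (sum_mset a)" using sa[of "size a"] by (simp add: sum_part)
  then have "odd (sum_mset (partwise_sum a ?c)) \<longleftrightarrow> odd (sum_mset ?c)"
    by (simp add: sum_mset_partwise_sum[OF part pc])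
  also have "\<dots> \<longleftrightarrow> X = Type_B"
  proof (cases "odd s")
    case True
    then show ?thesis using sc parity by simp
  next
    case False
    then have "X = Type_C" using s by (cases X) auto
    moreover have "even (sum_mset ?c)"
    proof (cases "odd (u + sum_mset q)")
      case True
      then have "odd (sum_mset ?c + 1)" using False sc by (simp add: add.commute)
      then show ?thesis by simp
    next
      case nodd: False
      then show ?thesis using False sc by (simp add: add.commute)
    qed
    ultimately show ?thesis by simp
  qed
  finally show "odd (sum_mset (partwise_sum a ?c)) \<longleftrightarrow> X = Type_B" .
qed

section \<open>The duality map\<close>

text \<open>The offset \<open>u\<close> depends on the type of the argument of \<open>d_BV\<close>:
  only for type C is the first part raised.\<close>

fun initial_offset :: "partition_type \<Rightarrow> nat" where
  "initial_offset Type_C = 1"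
| "initial_offset _ = 0"

text \<open>For types B and C, \<open>transpose_collapse_seq\<close> moves the outer transpose
  inside the collapse; for type D it is inside by definition.\<close>

lemma d_BV_eq_collapse_seq:
  assumes "(X, X') \<in> {(Type_B, Type_C), (Type_C, Type_B), (Type_D, Type_D)}" and "of_type X p"
  shows "d_BV X p = partition_of
    (collapse_seq (initial_offset X) (parity_offset X') (part (transpose_partition p)))"
proof -
  have p: "is_partition p" "odd (sum_mset p) \<longleftrightarrow> X = Type_B" "admissible (parity_offset X) (part p)"
    using assms(2) by (auto simp: of_type_iff)
  consider "X = Type_B" "X' = Type_C" | "X = Type_C" "X' = Type_B" | "X = Type_D" "X' = Type_D"
    using assms(1) by auto
  then show ?thesis
  proof cases
    case 1
    then show ?thesis using p by (simp add: collapse_lower_last transpose_collapse_seq)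
  next
    case 2
    then show ?thesis using p transpose_collapse_seq[of 1 p] by (simp add: collapse_raise_first)
  next
    case 3
    then show ?thesis
      using p collapse_Type_D[of "transpose_partition p"] by (simp add: sum_mset_transpose)
  qed
qed

text \<open>An even number of equal parts changes neither the parity of a multiplicity nor that of
  the size; if \<open>b\<close> is new, its old multiplicity 0 is even as well.\<close>

lemma of_type_union_replicate:
  assumes "of_type X p" and "b > 0"
  shows "of_type X (replicate_mset (2 * d) b + p)"
proof -
  have "even (count p b)" if "\<forall>k. k \<in># p \<and> P k \<longrightarrow> even (count p k)" "P b" for P
    using that by (cases "b \<in># p") (auto simp: not_in_iff)
  then show ?thesis
  proof -
  have "even (count p b)" if "\<forall>k. k \<in># p \<and> P k \<longrightarrow> even (count p k)" "P b" for P
    using that by (cases "b \<in># p") (auto simp: not_in_iff)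
  then show ?thesis
    using assms by (cases X) (auto simp: is_partition_def not_in_iff)
qed
qed

theorem lemma3p9:
  fixes X X' :: partition_type and p :: "nat multiset" and b d :: nat
  assumes "(X, X') \<in> {(Type_B, Type_C), (Type_C, Type_B), (Type_D, Type_D)}"
    and "of_type X p"
    and "b > 0" and "d > 0"
  shows "d_BV X (replicate_mset (2 * d) b + p) =
         collapse X' (partwise_sum (replicate_mset b (2 * d)) (d_BV X p))"
proof -
  let ?a = "replicate_mset b (2 * d)" and ?q = "transpose_partition p"
  let ?u = "initial_offset X" and ?s = "parity_offset X'"
  have a: "is_partition ?a" using assms(4) by (simp add: is_partition_def)
  have q: "is_partition ?q" by (rule is_partition_transpose)
  have "d_BV X (replicate_mset (2 * d) b + p) =
      partition_of (collapse_seq ?u ?s (part (partwise_sum ?a ?q)))"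
    using d_BV_eq_collapse_seq[OF assms(1) of_type_union_replicate[OF assms(2,3)]] assms(4)
    by (simp add: transpose_union_replicate)
  also have "\<dots> = partition_of (collapse_seq ?u ?s (\<lambda>i. part ?a i + part ?q i))"
    by (simp only: part_partwise_sum[OF a q])
  also have "\<dots> = collapse X' (partwise_sum ?a (partition_of (collapse_seq ?u ?s (part ?q))))"
  proof (rule collapse_partwise_sum_even[OF a, symmetric])
    show "even (part ?a i)" for i by (simp add: part_replicate_mset)
    show "?u \<le> 1" by (cases X) auto
    \<comment> \<open>Odd \<open>?s\<close> leaves the targets B and D. For B the argument has type
      C, whose even size becomes odd by \<open>?u = 1\<close>; for D the size is even and
      \<open>?u = 0\<close>.\<close>
    show "odd (sum_mset ?q + ?u) \<longleftrightarrow> X' = Type_B" if "odd ?s"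
      using assms(1,2) that by (auto simp: of_type_iff sum_mset_transpose)
  qed simp
  also have "partition_of (collapse_seq ?u ?s (part ?q)) = d_BV X p"
    by (rule d_BV_eq_collapse_seq[OF assms(1,2), symmetric])
  finally show ?thesis .
qed

end
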